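(* Let $q\in(0,1)$ and $\alpha,\beta>-1$. The eigenvectors of the operators $M_{n,q}^{\alpha,\beta}$, $n\in\mathbb N$, are the polynomials $P_{r,q}^{\alpha,\beta}$, $r\in\mathbb N$: for all $n,r\in\mathbb N$ one has $M_{n,q}^{\alpha,\beta}P_{r,q}^{\alpha,\beta}=\lambda_{n,r}^{\alpha,\beta}P_{r,q}^{\alpha,\beta}$ with eigenvalues $$\lambda_{n,r}^{\alpha,\beta}=q^{r(r+\alpha+\beta+1)}\,\frac{[n]_q!}{[n-r]_q!}\,\frac{\Gamma_q(n+\alpha+\beta+2)}{\Gamma_q(n+r+\alpha+\beta+2)}\ \text{ if } r\le n,\qquad \lambda_{n,r}^{\alpha,\beta}=0\ \text{ otherwise.}$$ Moreover, if $f:(0,1)\to\mathbb R$ satisfies condition $C(\alpha)$, then for every $n\in\mathbb N$ $$M_{n,q}^{\alpha,\beta}f=\sum_{r=0}^n\lambda_{n,r}^{\alpha,\beta}\,\frac{\langle f,P_{r,q}^{\alpha,\beta}\rangle_q^{\alpha,\beta}}{\nu_r^2}\,P_{r,q}^{\alpha,\beta},\qquad \nu_r^2=\langle P_{r,q}^{\alpha,\beta},P_{r,q}^{\alpha,\beta}\rangle_q^{\alpha,\beta}.$$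
   Context: For real $a$, $[a]_q=\frac{1-q^a}{1-q}$; $[n]_q!=\prod_{j=1}^n[j]_q$; $\begin{bmatrix}n\\k\end{bmatrix}_q=\frac{[n]_q!}{[k]_q!\,[n-k]_q!}$. For real $a$, $(1-x)_q^a=\prod_{j=0}^\infty\frac{1-q^jx}{1-q^{j+a}x}$, and $\Gamma_q(a+1)=(1-q)_q^a/(1-q)^a$ (here $(1-q)_q^a$ is $(1-x)_q^a$ at $x=q$). The Jackson integral is $\int_0^ah(t)\,d_qt=a(1-q)\sum_{i\ge0}q^ih(q^ia)$. Put $b_{n,k,q}(x)=\begin{bmatrix}n\\k\end{bmatrix}_qx^k(1-x)_q^{n-k}$, $0\le k\le n$. For $f:(0,1)\to\mathbb R$, $$M_{n,q}^{\alpha,\beta}f(x)=\sum_{k=0}^n f_{n,k,q}^{\alpha,\beta}\,b_{n,k,q}(x),\qquad f_{n,k,q}^{\alpha,\beta}=\frac{\int_0^1t^{k+\alpha}(1-qt)_q^{n-k+\beta}f(q^{\beta+1}t)\,d_qt}{\int_0^1t^{k+\alpha}(1-qt)_q^{n-k+\beta}\,d_qt}.$$ Condition $C(\alpha)$: there exist $\gamma\ge0$ with $\alpha>\gamma-1$ and $A\in(0,1]$ such that $x^\gamma f(x)$ is bounded on $(0,A]$ (for $A=1$, on $(0,1)$). Bilinear form: $\langle f,g\rangle_q^{\alpha,\beta}=q^{(\alpha+1)(\beta+1)}(1-q)\sum_{i=0}^\infty q^iq^{i\alpha}(1-q^{i+1})_q^\beta f(q^{i+\beta+1})g(q^{i+\beta+1})$;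 it is an inner product on polynomials, and $(P_{r,q}^{\alpha,\beta})_{r\in\mathbb N}$ is the sequence of orthogonal polynomials for it with $\deg P_{r,q}^{\alpha,\beta}=r$ and $P_{r,q}^{\alpha,\beta}(0)=\frac{[\alpha+r]_q\cdots[\alpha+1]_q}{[r]_q!}$. *)

theory Defs
  imports "HOL-Analysis.Analysis" "HOL-Computational_Algebra.Polynomial"
begin

definition qnum :: "real \<Rightarrow> real \<Rightarrow> real" where
  "qnum q a = (1 - q powr a) / (1 - q)"

definition qfact :: "real \<Rightarrow> nat \<Rightarrow> real" where
  "qfact q n = (\<Prod>j=1..n. qnum q (real j))"

definition qbinom :: "real \<Rightarrow> nat \<Rightarrow> nat \<Rightarrow> real" where
  "qbinom q n k = qfact q n / (qfact q k * qfact q (n - k))"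

text \<open>\<open>qpow q x a\<close> is $(1-x)_q^a$ for a real exponent \<open>a\<close>.\<close>

definition qpow :: "real \<Rightarrow> real \<Rightarrow> real \<Rightarrow> real" where
  "qpow q x a = (\<Prod>j. (1 - q ^ j * x) / (1 - q powr (real j + a) * x))"

text \<open>
  For a natural exponent the infinite product telescopes to the polynomial below
  (lemma \<open>qpow_of_nat\<close>). The polynomial form is also correct at the removable
  singularities, for instance at \<open>m = 0\<close>, \<open>x = 1\<close>, where \<open>qpow\<close> contains the factor \<open>0 / 0 = 0\<close>.
\<close>

definition qpow_nat :: "real \<Rightarrow> real \<Rightarrow> nat \<Rightarrow> real" where
  "qpow_nat q x m = (\<Prod>j<m. 1 - q ^ j * x)"

lemma qpow_of_nat:
  assumes q: "0 < q" "q < 1" and x: "\<And>j. q ^ (j + m) * x \<noteq> 1"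
  shows "qpow q x (real m) = qpow_nat q x m"
proof -
  define a where "a = (\<lambda>j. 1 - q ^ j * x)"
  define f where "f = (\<lambda>j. a j / a (j + m))"
  have f_eq: "(\<lambda>j. (1 - q ^ j * x) / (1 - q powr (real j + real m) * x)) = f"
    using q by (simp add: f_def a_def fun_eq_iff powr_add powr_realpow power_add)
  have nz: "a (j + m) \<noteq> 0" for j
    using x[of j] by (simp add: a_def)
  have a_lim: "a \<longlonglongrightarrow> 1"
    using tendsto_diff[OF tendsto_const tendsto_mult_right[OF LIMSEQ_power_zero, of q x], of 1] q
    by (simp add: a_def)
  have am_lim: "(\<lambda>j. a (j + m)) \<longlonglongrightarrow> 1"
    using a_lim by (rule LIMSEQ_ignore_initial_segment)
  have "eventually (\<lambda>j. a (j + m) > 1/2) sequentially"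
    using order_tendstoD(1)[OF am_lim, of "1/2"] by simp
  then have ev: "eventually (\<lambda>j. norm (norm (f j - 1)) \<le> 4 * \<bar>x\<bar> * q ^ j) sequentially"
  proof eventually_elim
    case (elim j)
    have "f j - 1 = (a j - a (j + m)) / a (j + m)"
      using nz[of j] by (simp add: f_def field_simps)
    also have "\<bar>\<dots>\<bar> = \<bar>a j - a (j + m)\<bar> / a (j + m)"
      using elim by simp
    also have "\<dots> \<le> \<bar>a j - a (j + m)\<bar> / (1/2)"
      using elim by (intro divide_left_mono) auto
    also have "\<bar>a j - a (j + m)\<bar> = q ^ j * (1 - q ^ m) * \<bar>x\<bar>"
    proof -
      have "a j - a (j + m) = - (q ^ j * (1 - q ^ m) * x)"
        by (simp add: a_def algebra_simps power_add)
      moreover have "q ^ m \<le> 1" using q by (simp add: power_le_one)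
      ultimately show ?thesis using q by (simp add: abs_mult)
    qed
    also have "q ^ j * (1 - q ^ m) * \<bar>x\<bar> / (1/2) \<le> q ^ j * 1 * \<bar>x\<bar> / (1/2)"
      using q by (intro divide_right_mono mult_right_mono mult_left_mono) auto
    also have "\<dots> \<le> 4 * \<bar>x\<bar> * q ^ j"
      using q by simp
    finally show ?case by simp
  qed
  have "summable (\<lambda>j. 4 * \<bar>x\<bar> * q ^ j)"
    using q by (intro summable_mult summable_geometric) auto
  then have "summable (\<lambda>j. norm (f j - 1))"
    by (rule summable_comparison_test_ev[OF ev])
  then have "abs_convergent_prod f"
    by (simp add: abs_convergent_prod_conv_summable)
  then have "convergent_prod f"
    by (rule abs_convergent_prod_imp_convergent_prod)
  then have 1: "(\<lambda>n. \<Prod>j\<le>n. f j) \<longlonglongrightarrow> prodinf f"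
    by (rule convergent_prod_LIMSEQ)
  have tele: "(\<Prod>j<N. f j) = (\<Prod>j<m. a j) / (\<Prod>j<m. a (j + N))"
    if "\<And>j. a (j + N) \<noteq> 0" for N
  proof (rule eq_divide_imp)
    show "(\<Prod>j<m. a (j + N)) \<noteq> 0" using that by simp
    have split: "(\<Prod>j<N'. a j) * (\<Prod>j<m'. a (j + N')) = (\<Prod>j<N' + m'. a j)" for N' m'
      by (induction m') (simp_all add: ac_simps)
    have nz': "(\<Prod>j<N. a (j + m)) \<noteq> 0" using nz by simp
    show "(\<Prod>j<N. f j) * (\<Prod>j<m. a (j + N)) = (\<Prod>j<m. a j)"
      using split[of N m] split[of m N] nz'
      by (simp add: f_def prod_dividef field_simps add.commute)
  qed
  have "eventually (\<lambda>j. a j > 0) sequentially"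
    using order_tendstoD(1)[OF a_lim, of 0] by simp
  then obtain N0 where N0: "\<And>j. j \<ge> N0 \<Longrightarrow> a j > 0"
    by (auto simp: eventually_sequentially)
  have "(\<lambda>N. (\<Prod>j<m. a j) / (\<Prod>j<m. a (j + N))) \<longlonglongrightarrow> (\<Prod>j<m. a j) / (\<Prod>j<m. 1)"
  proof (intro tendsto_divide tendsto_const tendsto_prod)
    show "(\<lambda>N. a (j + N)) \<longlonglongrightarrow> 1" for j
      using LIMSEQ_ignore_initial_segment[OF a_lim, of j] by (simp add: add.commute)
  qed simp
  then have "(\<lambda>N. (\<Prod>j<m. a j) / (\<Prod>j<m. a (j + N))) \<longlonglongrightarrow> (\<Prod>j<m. a j)"
    by simp
  then have "(\<lambda>N. \<Prod>j<N. f j) \<longlonglongrightarrow> (\<Prod>j<m. a j)"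
  proof (rule Lim_transform_eventually)
    show "\<forall>\<^sub>F N in sequentially. (\<Prod>j<m. a j) / (\<Prod>j<m. a (j + N)) = (\<Prod>j<N. f j)"
      using eventually_ge_at_top[of N0]
    proof eventually_elim
      case (elim N)
      have "a (j + N) \<noteq> 0" for j using N0[of "j + N"] elim by simp
      then show ?case by (simp add: tele)
    qed
  qed
  then have "(\<lambda>n. \<Prod>j\<le>n. f j) \<longlonglongrightarrow> (\<Prod>j<m. a j)"
    by (subst (asm) filterlim_sequentially_Suc[symmetric]) (simp add: lessThan_Suc_atMost)
  with 1 have "prodinf f = (\<Prod>j<m. a j)"
    by (rule LIMSEQ_unique)
  then show ?thesis
    by (simp add: qpow_def qpow_nat_def f_eq a_def)
qed

definition qGamma :: "real \<Rightarrow> real \<Rightarrow> real" where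
  "qGamma q s = qpow q q (s - 1) / (1 - q) powr (s - 1)"

definition jackson_integral :: "real \<Rightarrow> real \<Rightarrow> (real \<Rightarrow> real) \<Rightarrow> real" where
  "jackson_integral q a h = a * (1 - q) * (\<Sum>i. q ^ i * h (q ^ i * a))"

definition qbernstein :: "real \<Rightarrow> nat \<Rightarrow> nat \<Rightarrow> real \<Rightarrow> real" where
  "qbernstein q n k x = qbinom q n k * x ^ k * qpow_nat q x (n - k)"

definition qDurrmeyer_coeff ::
    "real \<Rightarrow> real \<Rightarrow> real \<Rightarrow> nat \<Rightarrow> nat \<Rightarrow> (real \<Rightarrow> real) \<Rightarrow> real" where
  "qDurrmeyer_coeff q \<alpha> \<beta> n k f =
     jackson_integral q 1 (\<lambda>t. t powr (real k + \<alpha>) * qpow q (q * t) (real (n - k) + \<beta>)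
                                 * f (q powr (\<beta> + 1) * t))
     / jackson_integral q 1 (\<lambda>t. t powr (real k + \<alpha>) * qpow q (q * t) (real (n - k) + \<beta>))"

text \<open>
  The Jackson sums evaluate \<open>f\<close> only at the points \<open>q powr (i + \<beta> + 1)\<close>, which lie in
  \<open>{0<..<1}\<close> when \<open>\<beta> > -1\<close>; the values of \<open>f\<close> outside this interval play no role here,
  nor in \<open>condition_C\<close> and \<open>qinner\<close> below.
\<close>

definition qDurrmeyer ::
    "real \<Rightarrow> real \<Rightarrow> real \<Rightarrow> nat \<Rightarrow> (real \<Rightarrow> real) \<Rightarrow> real \<Rightarrow> real" where
  "qDurrmeyer q \<alpha> \<beta> n f x = (\<Sum>k\<le>n. qDurrmeyer_coeff q \<alpha> \<beta> n k f * qbernstein q n k x)"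

definition condition_C :: "real \<Rightarrow> (real \<Rightarrow> real) \<Rightarrow> bool" where
  "condition_C \<alpha> f \<longleftrightarrow>
     (\<exists>\<gamma> A. \<gamma> \<ge> 0 \<and> \<alpha> > \<gamma> - 1 \<and> A \<in> {0<..1} \<and>
            bounded ((\<lambda>x. x powr \<gamma> * f x) ` ({0<..A} \<inter> {0<..<1})))"

definition qinner ::
    "real \<Rightarrow> real \<Rightarrow> real \<Rightarrow> (real \<Rightarrow> real) \<Rightarrow> (real \<Rightarrow> real) \<Rightarrow> real" where
  "qinner q \<alpha> \<beta> f g =
     q powr ((\<alpha> + 1) * (\<beta> + 1)) * (1 - q) *
     (\<Sum>i. q ^ i * q powr (real i * \<alpha>) * qpow q (q ^ (i + 1)) \<beta>
            * f (q powr (real i + \<beta> + 1)) * g (q powr (real i + \<beta> + 1)))"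

definition orthogonal_poly_seq ::
    "real \<Rightarrow> real \<Rightarrow> real \<Rightarrow> (nat \<Rightarrow> real poly) \<Rightarrow> bool" where
  "orthogonal_poly_seq q \<alpha> \<beta> P \<longleftrightarrow>
     (\<forall>r. degree (P r) = r) \<and>
     (\<forall>r. poly (P r) 0 = (\<Prod>j=1..r. qnum q (\<alpha> + real j)) / qfact q r) \<and>
     (\<forall>r s. r \<noteq> s \<longrightarrow> qinner q \<alpha> \<beta> (poly (P r)) (poly (P s)) = 0)"

definition qeigenvalue :: "real \<Rightarrow> real \<Rightarrow> real \<Rightarrow> nat \<Rightarrow> nat \<Rightarrow> real" where
  "qeigenvalue q \<alpha> \<beta> n r =
     (if r \<le> n then
        q powr (real r * (real r + \<alpha> + \<beta> + 1)) * (qfact q n / qfact q (n - r))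
        * (qGamma q (real n + \<alpha> + \<beta> + 2) / qGamma q (real n + real r + \<alpha> + \<beta> + 2))
      else 0)"

end

theory Submission
  imports Defs
begin

text \<open>
  Let \<open>L g\<close> be the sum of \<open>g\<close> against the $q$-Jacobi weight over the lattice points
  $q^{i+\beta+1}$, so that the bilinear form is a positive multiple of \<open>L (f * g)\<close>. Splitting
  $(1-qt)_q^{n-k+\beta}=(1-qt)_q^{\beta}\,(1-q^{\beta+1}t)_q^{n-k}$ turns the Durrmeyer coefficient
  of \<open>f\<close> into the quotient \<open>L (f * b) / L b\<close>, where \<open>b\<close> is the \<open>k\<close>-th Bernstein polynomial
  (\<open>qDurrmeyer_coeff_eq_lattice_sum\<close>). Two properties of the operator follow.

  It is self-adjoint (\<open>qDurrmeyer_self_adjoint\<close>), because it is a sum of multiples of the rank one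
  maps that send \<open>f\<close> to \<open>L (f * b) b\<close>.

  It maps polynomials of degree at most \<open>d\<close> to polynomials of degree at most \<open>d\<close>
  and multiplies the coefficient of $x^d$ by an explicit number (\<open>coeff_durrmeyer_poly\<close>).
  Indeed the functional equation of the $q$-beta sums (\<open>qbeta_sum_add_1\<close>) shows that the
  coefficient of $x^m$ at the \<open>k\<close>-th Bernstein polynomial is a constant times
  $\prod_{j=1}^{m}(1-q^{\alpha+j}q^k)$, and the $q$-difference equation of the Bernstein
  polynomials (\<open>qbernstein_q_shift\<close>) lets multiplication by $q^k$ act on a Bernstein sum by an
  operator that raises the degree by at most one. Iterating this on
  the partition of unity gives both the degree bound and the leading coefficient.

  A self-adjoint operator that respects the degree filtration has the orthogonal polynomials as
  eigenvectors, with the leading coefficient factors as eigenvalues (\<open>durrmeyer_eigen\<close>). A factor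
  $q^n-q^n$ in that number makes it vanish for \<open>r > n\<close>. For general \<open>f\<close> the image is a polynomial of
  degree at most \<open>n\<close>; moving the operator to the other side in its Fourier coefficients gives
  the spectral formula (\<open>qDurrmeyer_spectral\<close>). Condition $C(\alpha)$ enters only through the
  absolute convergence of \<open>L f\<close>.
\<close>

section \<open>Infinite q-products\<close>

definition qpoch :: "real \<Rightarrow> real \<Rightarrow> real" where
  "qpoch q x = (\<Prod>j. 1 - q ^ j * x)"

locale q_base =
  fixes q :: real
  assumes q_pos: "0 < q" and q_less_1: "q < 1"
begin

lemma convergent_prod_qpoch: "convergent_prod (\<lambda>j. 1 - q ^ j * x)"
proof -
  have "summable (\<lambda>j. \<bar>x\<bar> * q ^ j)"
    using q_pos q_less_1 by (intro summable_mult summable_geometric) auto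
  then have "summable (\<lambda>j. norm ((1 - q ^ j * x) - 1))"
    using q_pos by (simp add: abs_mult mult.commute)
  then show ?thesis
    by (intro abs_convergent_prod_imp_convergent_prod)
       (simp add: abs_convergent_prod_conv_summable)
qed

lemma qpoch_factor_pos:
  assumes "0 \<le> x" "x < 1"
  shows "0 < 1 - q ^ j * x"
proof -
  have "q ^ j * x \<le> 1 * x"
    using assms q_pos q_less_1 by (intro mult_right_mono power_le_one) auto
  with assms show ?thesis by simp
qed

lemma qpoch_pos:
  assumes "0 \<le> x" "x < 1"
  shows "0 < qpoch q x"
proof -
  have "(\<lambda>n. \<Prod>j\<le>n. 1 - q ^ j * x) \<longlonglongrightarrow> qpoch q x"
    unfolding qpoch_def by (rule convergent_prod_LIMSEQ[OF convergent_prod_qpoch])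
  then have "0 \<le> qpoch q x"
    by (rule LIMSEQ_le_const)
       (intro exI allI impI prod_nonneg less_imp_le[OF qpoch_factor_pos] assms)
  moreover have "qpoch q x \<noteq> 0"
    unfolding qpoch_def
    by (rule prodinf_nonzero[OF convergent_prod_qpoch])
       (use qpoch_factor_pos[OF assms] in \<open>auto simp: less_imp_neq[symmetric]\<close>)
  ultimately show ?thesis by simp
qed

lemma qpoch_split:
  assumes "0 \<le> x" "x < 1"
  shows "qpoch q x = qpow_nat q x m * qpoch q (q ^ m * x)"
proof -
  have nz: "\<And>j. 1 - q ^ j * x \<noteq> 0"
    using qpoch_factor_pos[OF assms] by (metis less_irrefl)
  have "(\<Prod>j. 1 - q ^ (j + m) * x) = (\<Prod>j. 1 - q ^ j * x) / (\<Prod>j<m. 1 - q ^ j * x)"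
    using prodinf_divide_initial_segment[OF convergent_prod_qpoch nz] .
  moreover have "(\<Prod>j<m. 1 - q ^ j * x) \<noteq> 0"
    using nz by simp
  ultimately show ?thesis
    by (simp add: qpoch_def qpow_nat_def power_add mult.assoc)
qed

lemma qpow_eq_qpoch:
  "qpow q x a = qpoch q x / qpoch q (q powr a * x)"
proof -
  have "q powr (real j + a) * x = q ^ j * (q powr a * x)" for j
    using q_pos by (simp add: powr_add powr_realpow)
  then show ?thesis
    unfolding qpow_def qpoch_def
    by (simp only: prodinf_divide[OF convergent_prod_qpoch convergent_prod_qpoch])
qed

text \<open>
  The law $(1-x)_q^{a+m}=(1-x)_q^a\,(1-q^ax)_q^m$. With $a=\beta$ it separates the weight of the
  inner product from the polynomial factor of a Durrmeyer coefficient; with \<open>m = 1\<close> it is the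
  functional equation of $\Gamma_q$.
\<close>

lemma qpow_add_nat:
  assumes "0 \<le> x" "q powr a * x < 1"
  shows "qpow q x (real m + a) = qpow q x a * qpow_nat q (q powr a * x) m"
proof -
  let ?y = "q powr a * x"
  have y: "0 \<le> ?y" "?y < 1" using assms by auto
  have eq: "q powr (real m + a) * x = q ^ m * ?y"
    using q_pos by (simp add: powr_add powr_realpow)
  have "q ^ m * ?y \<le> 1 * ?y"
    using y q_pos q_less_1 by (intro mult_right_mono power_le_one) auto
  then have "q ^ m * ?y < 1" using y by linarith
  with y have "0 < qpoch q (q ^ m * ?y)" "0 < qpoch q ?y"
    using q_pos by (auto intro!: qpoch_pos simp del: mult_le_cancel_right1)
  with qpoch_split[OF y, of m] show ?thesis
    unfolding qpow_eq_qpoch eq by (auto simp: field_simps)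
qed

lemma q_powr_less_1: "0 < s \<Longrightarrow> q powr s < 1"
  using q_pos q_less_1 powr_less_mono'[of q 0 s] by simp

lemma qpow_lattice_pos:
  assumes "-1 < b"
  shows "0 < qpow q (q ^ Suc i) b"
proof -
  have 1: "q ^ Suc i < 1" using q_pos q_less_1 by (intro power_Suc_less_one) auto
  have "q powr b * q ^ Suc i = q powr (b + real (Suc i))"
    by (simp only: powr_add powr_realpow[OF q_pos])
  also have "\<dots> < 1" using assms by (intro q_powr_less_1) auto
  finally show ?thesis
    unfolding qpow_eq_qpoch using 1 q_pos
    by (intro divide_pos_pos qpoch_pos) auto
qed

text \<open>
  Both infinite products lose their first factor when the lattice index grows by one. In
  this multiplied form the identity drives the ratio test and the summation by parts for the $q$-beta sums.
\<close>

lemma qpow_lattice_step: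
  assumes "-1 < b"
  shows "(1 - q ^ Suc i) * qpow q (q ^ Suc (Suc i)) b
           = (1 - q powr (real (Suc i) + b)) * qpow q (q ^ Suc i) b"
proof -
  have x: "0 \<le> q ^ Suc i" "q ^ Suc i < 1"
    using q_pos q_less_1 by (auto simp del: power_Suc intro: power_Suc_less_one)
  let ?y = "q powr b * q ^ Suc i"
  have y: "?y = q powr (real (Suc i) + b)"
    by (simp only: powr_add powr_realpow[OF q_pos] mult.commute)
  have y1: "0 \<le> ?y" "?y < 1"
    using assms unfolding y by (auto intro!: q_powr_less_1)
  have 1: "qpoch q (q ^ Suc i) = (1 - q ^ Suc i) * qpoch q (q ^ Suc (Suc i))"
    using qpoch_split[OF x, of 1] by (simp add: qpow_nat_def)
  have 2: "qpoch q ?y = (1 - ?y) * qpoch q (q * ?y)"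
    using qpoch_split[OF y1, of 1] by (simp add: qpow_nat_def)
  have "q * ?y \<le> 1 * ?y" using y1 q_less_1 by (intro mult_right_mono) auto
  then have "q * ?y < 1" using y1 by linarith
  then have 3: "0 < qpoch q (q * ?y)"
    using y1 q_pos by (intro qpoch_pos) simp_all
  have 4: "q powr b * q ^ Suc (Suc i) = q * ?y" by simp
  show ?thesis
    unfolding qpow_eq_qpoch 4 y[symmetric] 1 2
    using 3 y1 by (simp add: field_simps del: power_Suc)
qed

section \<open>The q-beta sums\<close>

text \<open>
  The summand, up to the factor $1-q$, of the Jackson integral over $[0,1]$ of
  $t^{s-1}(1-qt)_q^b$.
\<close>

definition jackson_term :: "real \<Rightarrow> real \<Rightarrow> nat \<Rightarrow> real" where
  "jackson_term s b i = q powr (real i * s) * qpow q (q ^ Suc i) b"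

definition qbeta_sum :: "real \<Rightarrow> real \<Rightarrow> real" where
  "qbeta_sum s b = (\<Sum>i. jackson_term s b i)"

lemma jackson_term_pos: "-1 < b \<Longrightarrow> 0 < jackson_term s b i"
  unfolding jackson_term_def using qpow_lattice_pos q_pos by simp

lemma jackson_term_Suc:
  assumes "-1 < b"
  shows "(1 - q ^ Suc i) * jackson_term s b (Suc i)
           = q powr s * (1 - q powr (real (Suc i) + b)) * jackson_term s b i"
proof -
  have "q powr (real (Suc i) * s) = q powr s * q powr (real i * s)"
    by (simp add: powr_add[symmetric] algebra_simps)
  then have "(1 - q ^ Suc i) * jackson_term s b (Suc i)
       = q powr s * q powr (real i * s) * ((1 - q ^ Suc i) * qpow q (q ^ Suc (Suc i)) b)"
    unfolding jackson_term_def by (simp add: mult_ac)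
  then show ?thesis
    unfolding qpow_lattice_step[OF assms] jackson_term_def by (simp add: mult_ac)
qed

lemma summable_jackson_term:
  assumes "0 < s" "-1 < b"
  shows "summable (jackson_term s b)"
proof -
  define r where "r = (\<lambda>i. q powr s * (1 - q powr (real (Suc i) + b)) / (1 - q ^ Suc i))"
  \<comment> \<open>Consecutive terms have ratio \<open>r i\<close>, which tends to $q^s<1$; \<open>c\<close> is the midpoint of $q^s$ and \<open>1\<close>.\<close>
  define c where "c = (q powr s + 1) / 2"
  have s1: "q powr s < 1" using assms by (intro q_powr_less_1)
  have "(\<lambda>i. q ^ Suc i) \<longlonglongrightarrow> 0"
    using q_pos q_less_1 by (intro LIMSEQ_Suc LIMSEQ_power_zero) auto
  then have "(\<lambda>i. q powr s * (1 - q powr b * q ^ Suc i) / (1 - q ^ Suc i))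
                \<longlonglongrightarrow> q powr s * (1 - q powr b * 0) / (1 - 0)"
    by (intro tendsto_intros) auto
  also have "(\<lambda>i. q powr s * (1 - q powr b * q ^ Suc i) / (1 - q ^ Suc i)) = r"
    unfolding r_def by (simp only: powr_add powr_realpow[OF q_pos] mult.commute)
  finally have "r \<longlonglongrightarrow> q powr s" by simp
  then have "eventually (\<lambda>i. r i < c) sequentially"
    using s1 by (intro order_tendstoD(2)) (auto simp: c_def)
  then obtain N where N: "\<And>i. i \<ge> N \<Longrightarrow> r i < c"
    by (auto simp: eventually_sequentially)
  show ?thesis
  proof (rule summable_ratio_test)
    show "c < 1" using s1 by (simp add: c_def)
  next
    fix i assume i: "N \<le> i"
    have "q ^ Suc i < 1" using q_pos q_less_1 by (intro power_Suc_less_one) auto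
    then have "jackson_term s b (Suc i) = r i * jackson_term s b i"
      using jackson_term_Suc[OF assms(2), of i s]
      unfolding r_def by (simp add: field_simps del: power_Suc)
    also have "\<dots> \<le> c * jackson_term s b i"
      using N[OF i] jackson_term_pos[OF assms(2), of s i] by (intro mult_right_mono) auto
    finally show "norm (jackson_term s b (Suc i)) \<le> c * norm (jackson_term s b i)"
      using jackson_term_pos[OF assms(2), of s] by (simp add: less_imp_le)
  qed
qed

lemma qbeta_sum_pos: "0 < s \<Longrightarrow> -1 < b \<Longrightarrow> 0 < qbeta_sum s b"
  unfolding qbeta_sum_def
  by (intro suminf_pos summable_jackson_term jackson_term_pos)

text \<open>
  This is $B_q(s+1,b+1)=B_q(s,b+1)\,[s]_q/[s+b+1]_q$, obtained by $q$-integration by parts: the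
  sequence $(1-q^i)\,q^{is}(1-q^{i+1})_q^b$ vanishes at $i=0$, so its sum does not
  change under a shift of the index, and both sums can be expressed by the two $q$-beta sums.
\<close>

lemma qbeta_sum_add_1:
  assumes "0 < s" "-1 < b"
  shows "qbeta_sum (s + 1) b = qbeta_sum s b * (1 - q powr s) / (1 - q powr (s + b + 1))"
proof -
  define g where "g = (\<lambda>i. (1 - q ^ i) * jackson_term s b i)"
  have term_add_1: "jackson_term (s + 1) b i = q ^ i * jackson_term s b i" for i
    using q_pos by (simp add: jackson_term_def powr_add powr_realpow algebra_simps)
  have sum0: "summable (jackson_term s b)" and sum1: "summable (jackson_term (s + 1) b)"
    using assms by (auto intro!: summable_jackson_term)
  have g_eq: "g = (\<lambda>i. jackson_term s b i - jackson_term (s + 1) b i)"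
    unfolding g_def term_add_1 by (simp add: algebra_simps)
  have g_sum: "summable g" "suminf g = qbeta_sum s b - qbeta_sum (s + 1) b"
    unfolding g_eq qbeta_sum_def using sum0 sum1
    by (auto intro: summable_diff suminf_diff[symmetric])
  have "g (Suc i) = q powr s * (jackson_term s b i - q powr (b + 1) * jackson_term (s + 1) b i)"
    for i
  proof -
    have "q powr (real (Suc i) + b) = q powr (b + 1) * q ^ i"
      using q_pos by (simp add: powr_realpow[symmetric] powr_add[symmetric] add_ac)
    then show ?thesis
      unfolding g_def jackson_term_Suc[OF assms(2)] term_add_1 by (simp add: algebra_simps)
  qed
  then have "(\<Sum>i. g (Suc i))
      = (\<Sum>i. q powr s * (jackson_term s b i - q powr (b + 1) * jackson_term (s + 1) b i))"
    by simp
  also have "\<dots> = q powr s * (qbeta_sum s b - q powr (b + 1) * qbeta_sum (s + 1) b)"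
    unfolding qbeta_sum_def using sum0 sum1
    by (simp add: suminf_mult suminf_diff[symmetric] summable_mult summable_diff)
  finally have "(\<Sum>i. g (Suc i))
      = q powr s * (qbeta_sum s b - q powr (b + 1) * qbeta_sum (s + 1) b)" .
  moreover have "(\<Sum>i. g (Suc i)) = suminf g"
    using suminf_split_head[OF g_sum(1)] by (simp add: g_def)
  moreover have "q powr s * q powr (b + 1) = q powr (s + b + 1)"
    by (simp add: powr_add[symmetric] add_ac)
  ultimately have "qbeta_sum (s + 1) b * (1 - q powr (s + b + 1))
       = qbeta_sum s b * (1 - q powr s)"
    unfolding g_sum(2) by algebra
  moreover have "q powr (s + b + 1) < 1" using assms by (intro q_powr_less_1) auto
  ultimately show ?thesis by (simp add: field_simps)
qed

lemma qbeta_sum_add_nat: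
  assumes "0 < s" "-1 < b"
  shows "qbeta_sum (s + real m) b
    = qbeta_sum s b * (\<Prod>j<m. (1 - q powr (s + real j)) / (1 - q powr (s + b + 1 + real j)))"
proof (induction m)
  case (Suc m)
  have "qbeta_sum (s + real (Suc m)) b = qbeta_sum ((s + real m) + 1) b"
    by (simp add: add_ac)
  also have "\<dots> = qbeta_sum (s + real m) b * (1 - q powr (s + real m))
                   / (1 - q powr (s + real m + b + 1))"
    using assms by (intro qbeta_sum_add_1) auto
  finally show ?case by (simp add: Suc.IH add_ac)
qed simp

section \<open>Bernstein polynomials\<close>

lemma qfact_nonzero: "qfact q n \<noteq> 0"
proof -
  have "0 < qnum q (real j)" if "1 \<le> j" for j
    using that q_less_1 q_powr_less_1[of "real j"] by (auto simp: qnum_def)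
  then show ?thesis unfolding qfact_def
    by (auto simp: prod_zero_iff) (metis less_irrefl)
qed

lemma qfact_Suc: "qfact q (Suc n) = qfact q n * (1 - q ^ Suc n) / (1 - q)"
proof -
  have "qnum q (real (Suc n)) = (1 - q ^ Suc n) / (1 - q)"
    unfolding qnum_def powr_realpow[OF q_pos] by simp
  then show ?thesis unfolding qfact_def by simp
qed

lemma qbinom_pascal:
  assumes "k < n"
  shows "qbinom q (Suc n) (Suc k) = q ^ (n - k) * qbinom q n k + qbinom q n (Suc k)"
proof -
  obtain d where d: "n = Suc (k + d)"
    using assms less_iff_Suc_add by auto
  have nz: "qfact q k \<noteq> 0" "qfact q d \<noteq> 0" "q ^ Suc k < 1" "q ^ Suc d < 1"
    using qfact_nonzero q_pos q_less_1 by (auto simp del: power_Suc intro!: power_Suc_less_one)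
  have e: "Suc n - Suc k = Suc d" "n - k = Suc d" "n - Suc k = d"
    using d by auto
  have pw: "q ^ Suc n = q ^ Suc d * q ^ Suc k" by (simp add: d power_add)
  have field_identity: "F * (D * K + D') / g / ((A * K / g) * (B * D' / g))
      = D * (F / (A * (B * D' / g))) + F / ((A * K / g) * B)"
    if "A \<noteq> 0" "B \<noteq> 0" "K \<noteq> 0" "D' \<noteq> 0" "g \<noteq> 0" for F A B K D D' g :: real
    using that by (simp add: field_simps)
  have numerator: "1 - q ^ Suc d * q ^ Suc k = q ^ Suc d * (1 - q ^ Suc k) + (1 - q ^ Suc d)"
    by (simp add: right_diff_distrib del: power_Suc)
  show ?thesis
    unfolding qbinom_def e qfact_Suc pw numerator using nz q_less_1
    by (intro field_identity) auto
qed

lemma qpow_nat_Suc: "qpow_nat q x (Suc m) = qpow_nat q x m * (1 - q ^ m * x)"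
  by (simp add: qpow_nat_def)

lemma qpow_nat_shift: "(1 - x) * qpow_nat q (q * x) m = qpow_nat q x m * (1 - q ^ m * x)"
proof -
  have "qpow_nat q x (Suc m) = (1 - x) * qpow_nat q (q * x) m"
    unfolding qpow_nat_def by (subst prod.lessThan_Suc_shift) (simp add: mult_ac)
  then show ?thesis by (simp add: qpow_nat_Suc)
qed

lemma qbinom_n_0: "qbinom q n 0 = 1" and qbinom_n_n: "qbinom q n n = 1"
  using qfact_nonzero by (auto simp: qbinom_def qfact_def)

text \<open>
  By the $q$-Pascal rule the polynomial of index $k$ and degree $n$ contributes
  $q^{n-k}x$ times itself to the one of index $k+1$ and $1-q^{n-k}x$ times itself to the one of index $k$ in
  degree $n+1$; these two factors add up to \<open>1\<close>.
\<close>

lemma sum_qbernstein: "(\<Sum>k\<le>n. qbernstein q n k x) = 1"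
proof (induction n)
  case 0
  show ?case by (simp add: qbernstein_def qbinom_n_0 qpow_nat_def)
next
  case (Suc n)
  let ?b = "\<lambda>k. qbernstein q n k x"
  have first: "qbernstein q (Suc n) 0 x = (1 - q ^ n * x) * ?b 0"
    by (simp add: qbernstein_def qbinom_n_0 qpow_nat_Suc)
  have last: "qbernstein q (Suc n) (Suc n) x = x * ?b n"
    by (simp add: qbernstein_def qbinom_n_n)
  have mid: "qbernstein q (Suc n) (Suc k) x
      = q ^ (n - k) * x * ?b k + (1 - q ^ (n - Suc k) * x) * ?b (Suc k)" if "k < n" for k
  proof -
    define d where "d = n - Suc k"
    then have d: "n - k = Suc d" "n - Suc k = d" using that by auto
    show ?thesis
      unfolding qbernstein_def qbinom_pascal[OF that] diff_Suc_Suc d qpow_nat_Suc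
      by (simp add: algebra_simps)
  qed
  have "(\<Sum>k\<le>Suc n. qbernstein q (Suc n) k x)
      = qbernstein q (Suc n) 0 x + (\<Sum>k<n. qbernstein q (Suc n) (Suc k) x)
        + qbernstein q (Suc n) (Suc n) x"
    by (simp add: sum.atMost_shift)
  also have "\<dots> = ((\<Sum>k<n. q ^ (n - k) * x * ?b k) + x * ?b n)
      + ((1 - q ^ n * x) * ?b 0 + (\<Sum>k<n. (1 - q ^ (n - Suc k) * x) * ?b (Suc k)))"
    by (simp add: first last mid sum.distrib)
  also have "(\<Sum>k<n. q ^ (n - k) * x * ?b k) + x * ?b n = (\<Sum>k\<le>n. q ^ (n - k) * x * ?b k)"
    by (simp flip: lessThan_Suc_atMost)
  also have "(1 - q ^ n * x) * ?b 0 + (\<Sum>k<n. (1 - q ^ (n - Suc k) * x) * ?b (Suc k))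
      = (\<Sum>k\<le>n. (1 - q ^ (n - k) * x) * ?b k)"
    by (simp add: sum.atMost_shift)
  also have "(\<Sum>k\<le>n. q ^ (n - k) * x * ?b k) + (\<Sum>k\<le>n. (1 - q ^ (n - k) * x) * ?b k)
      = (\<Sum>k\<le>n. ?b k)"
    by (simp add: sum.distrib[symmetric] algebra_simps)
  finally show ?case by (simp add: Suc.IH)
qed

text \<open>
  The $q$-shift $x\mapsto qx$ multiplies $x^k$ by $q^k$ and replaces $(1-x)_q^{n-k}$ by
  $(1-x)_q^{n-k}\,(1-q^{n-k}x)/(1-x)$. The point is that the coefficients on the right do not depend on
  \<open>k\<close>, so the identity carries over to arbitrary sums of Bernstein polynomials.
\<close>

lemma qbernstein_q_shift:
  assumes "k \<le> n"
  shows "q ^ k * qbernstein q n k x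
           = (1 - x) * qbernstein q n k (q * x) + q ^ n * x * qbernstein q n k x"
proof -
  have "(1 - x) * qbernstein q n k (q * x)
      = q ^ k * qbinom q n k * x ^ k * ((1 - x) * qpow_nat q (q * x) (n - k))"
    by (simp add: qbernstein_def power_mult_distrib mult_ac)
  also have "\<dots> = q ^ k * (1 - q ^ (n - k) * x) * qbernstein q n k x"
    unfolding qpow_nat_shift by (simp add: qbernstein_def mult_ac)
  also have "q ^ k * (1 - q ^ (n - k) * x) = q ^ k - q ^ n * x"
    using assms by (simp add: algebra_simps power_add[symmetric])
  finally show ?thesis by (simp add: algebra_simps)
qed

text \<open>
  The recursion applies $1-aq^{d+1}S$, where $S$ is the operator
  $F(x)\mapsto(1-x)F(qx)+q^nxF(x)$, which acts on a Bernstein sum by multiplying the coefficient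
  of index $k$ by $q^k$.
\<close>

primrec moment_poly :: "real \<Rightarrow> nat \<Rightarrow> nat \<Rightarrow> real poly" where
  "moment_poly a n 0 = 1"
| "moment_poly a n (Suc d) = moment_poly a n d -
     smult (a * q ^ Suc d)
       ([:1, -1:] * pcompose (moment_poly a n d) [:0, q:] + smult (q ^ n) ([:0, 1:] * moment_poly a n d))"

lemma sum_moment_qbernstein:
  "(\<Sum>k\<le>n. (\<Prod>j<d. 1 - a * q ^ Suc j * q ^ k) * qbernstein q n k x) = poly (moment_poly a n d) x"
proof (induction d arbitrary: x)
  case 0
  show ?case by (simp add: sum_qbernstein)
next
  case (Suc d)
  let ?h = "\<lambda>k. \<Prod>j<d. 1 - a * q ^ Suc j * q ^ k"
  have "(\<Sum>k\<le>n. (\<Prod>j<Suc d. 1 - a * q ^ Suc j * q ^ k) * qbernstein q n k x)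
      = (\<Sum>k\<le>n. ?h k * qbernstein q n k x - a * q ^ Suc d * (?h k * (q ^ k * qbernstein q n k x)))"
    by (intro sum.cong refl) (simp add: algebra_simps)
  also have "\<dots> = (\<Sum>k\<le>n. ?h k * qbernstein q n k x - a * q ^ Suc d *
      ((1 - x) * (?h k * qbernstein q n k (q * x)) + q ^ n * x * (?h k * qbernstein q n k x)))"
    by (intro sum.cong refl, subst qbernstein_q_shift) (auto simp: algebra_simps)
  also have "\<dots> = poly (moment_poly a n d) x - a * q ^ Suc d *
      ((1 - x) * poly (moment_poly a n d) (q * x) + q ^ n * x * poly (moment_poly a n d) x)"
    unfolding Suc.IH[symmetric] by (simp only: sum_subtractf sum.distrib sum_distrib_left[symmetric])
  also have "\<dots> = poly (moment_poly a n (Suc d)) x"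
    by (simp add: poly_pcompose algebra_simps)
  finally show ?case .
qed

text \<open>
  The operator $S$ raises the degree by at most one and multiplies the leading coefficient of a
  polynomial of degree $d$ by $q^n-q^d$.
\<close>

lemma coeff_moment_poly:
  "(\<forall>i>d. coeff (moment_poly a n d) i = 0) \<and>
   coeff (moment_poly a n d) d = (\<Prod>j<d. a * q ^ Suc j * (q ^ j - q ^ n))"
proof (induction d)
  case 0
  show ?case by (auto simp: coeff_pCons split: nat.splits)
next
  case (Suc d)
  have c: "coeff (moment_poly a n (Suc d)) (Suc i)
      = coeff (moment_poly a n d) (Suc i) - a * q ^ Suc d *
          (q ^ Suc i * coeff (moment_poly a n d) (Suc i)
            + (q ^ n - q ^ i) * coeff (moment_poly a n d) i)" for i
    by (simp add: coeff_pcompose_linear algebra_simps)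
  show ?case
  proof (intro conjI allI impI)
    fix i assume "Suc d < i"
    then obtain i' where "i = Suc i'" "d < i'" by (cases i) auto
    then show "coeff (moment_poly a n (Suc d)) i = 0"
      using Suc.IH by (simp only: c) auto
  next
    have "coeff (moment_poly a n (Suc d)) (Suc d)
        = coeff (moment_poly a n d) d * (a * q ^ Suc d * (q ^ d - q ^ n))"
      using Suc.IH by (simp only: c) (auto simp: algebra_simps)
    then show "coeff (moment_poly a n (Suc d)) (Suc d)
        = (\<Prod>j<Suc d. a * q ^ Suc j * (q ^ j - q ^ n))"
      using Suc.IH by simp
  qed
qed

end

section \<open>The weighted sum over the lattice\<close>

locale q_durrmeyer = q_base +
  fixes \<alpha> \<beta> :: real
  assumes alpha: "\<alpha> > -1" and beta: "\<beta> > -1"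
begin

definition node :: "nat \<Rightarrow> real" where
  "node i = q powr (real i + \<beta> + 1)"

definition weight :: "nat \<Rightarrow> real" where
  "weight = jackson_term (\<alpha> + 1) \<beta>"

definition lattice_sum :: "(real \<Rightarrow> real) \<Rightarrow> real" where
  "lattice_sum g = (\<Sum>i. weight i * g (node i))"

text \<open>
  Absolute convergence rather than plain convergence, because it survives multiplication by a bounded
  function.
\<close>

definition admissible :: "(real \<Rightarrow> real) \<Rightarrow> bool" where
  "admissible f \<longleftrightarrow> summable (\<lambda>i. \<bar>weight i * f (node i)\<bar>)"

text \<open>
  Bernstein polynomials without the $q$-binomial coefficient, which cancels in the normalised
  coefficients.
\<close>

definition bern :: "nat \<Rightarrow> nat \<Rightarrow> real \<Rightarrow> real" where
  "bern n k x = x ^ k * qpow_nat q x (n - k)"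

lemma node_pos: "0 < node i" and node_less_1: "node i < 1"
  using q_pos beta by (auto simp: node_def intro!: q_powr_less_1)

lemma weight_pos: "0 < weight i"
  unfolding weight_def using beta by (rule jackson_term_pos)

lemma inj_node: "inj node"
proof
  fix i j assume "node i = node j"
  then show "i = j"
    unfolding node_def using q_pos q_less_1 by (auto simp: powr_inj)
qed

lemma node_tendsto_0: "node \<longlonglongrightarrow> 0"
proof -
  have "node i = q powr (\<beta> + 1) * q ^ i" for i
    using q_pos by (simp add: node_def powr_realpow[symmetric] powr_add[symmetric] add_ac)
  then have "node = (\<lambda>i. q powr (\<beta> + 1) * q ^ i)" by auto
  moreover have "(\<lambda>i. q powr (\<beta> + 1) * q ^ i) \<longlonglongrightarrow> q powr (\<beta> + 1) * 0"
    using q_pos q_less_1 by (intro tendsto_intros LIMSEQ_power_zero) auto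
  ultimately show ?thesis by simp
qed

lemma admissible_add:
  assumes "admissible f" "admissible g"
  shows "admissible (\<lambda>x. f x + g x)"
  unfolding admissible_def
proof (rule summable_comparison_test')
  show "summable (\<lambda>i. \<bar>weight i * f (node i)\<bar> + \<bar>weight i * g (node i)\<bar>)"
    using assms unfolding admissible_def by (rule summable_add)
  show "norm \<bar>weight i * (f (node i) + g (node i))\<bar>
      \<le> \<bar>weight i * f (node i)\<bar> + \<bar>weight i * g (node i)\<bar>" for i
    by (simp add: distrib_left abs_triangle_ineq)
qed

lemma admissible_cmult: "admissible f \<Longrightarrow> admissible (\<lambda>x. c * f x)"
  unfolding admissible_def
  using summable_mult[of "\<lambda>i. \<bar>weight i * f (node i)\<bar>" "\<bar>c\<bar>"] by (simp add: abs_mult mult_ac)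

lemma admissible_0: "admissible (\<lambda>x. 0)"
  by (simp add: admissible_def)

lemma admissible_1: "admissible (\<lambda>x. 1)"
  unfolding admissible_def
  using summable_jackson_term[of "\<alpha> + 1" \<beta>] alpha beta weight_pos
  by (simp add: weight_def[symmetric] less_imp_le)

lemma admissible_mult_bounded:
  assumes "admissible f" "\<And>x. 0 \<le> x \<Longrightarrow> x \<le> 1 \<Longrightarrow> \<bar>g x\<bar> \<le> B"
  shows "admissible (\<lambda>x. f x * g x)"
  unfolding admissible_def
proof (rule summable_comparison_test')
  show "summable (\<lambda>i. B * \<bar>weight i * f (node i)\<bar>)"
    using assms(1) unfolding admissible_def by (rule summable_mult)
  show "norm \<bar>weight i * (f (node i) * g (node i))\<bar> \<le> B * \<bar>weight i * f (node i)\<bar>" for i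
    using mult_right_mono[OF assms(2)[of "node i"], of "\<bar>weight i * f (node i)\<bar>"]
      node_pos[of i] node_less_1[of i] by (simp add: abs_mult mult_ac)
qed

lemma admissible_mult_poly:
  assumes "admissible f"
  shows "admissible (\<lambda>x. f x * poly p x)"
proof -
  have "compact (poly p ` {0..1})"
    by (intro compact_continuous_image continuous_intros) auto
  then obtain B where "\<And>x. x \<in> {0..1} \<Longrightarrow> \<bar>poly p x\<bar> \<le> B"
    using compact_imp_bounded by (force simp: bounded_iff)
  then show ?thesis using assms by (intro admissible_mult_bounded) auto
qed

lemma admissible_poly: "admissible (poly p)"
  using admissible_mult_poly[OF admissible_1, of p] by simp

lemma lattice_sum_add:
  assumes "admissible f" "admissible g"
  shows "lattice_sum (\<lambda>x. f x + g x) = lattice_sum f + lattice_sum g"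
  using assms[unfolded admissible_def, THEN summable_rabs_cancel]
  by (simp add: lattice_sum_def distrib_left suminf_add)

lemma lattice_sum_cmult: "admissible f \<Longrightarrow> lattice_sum (\<lambda>x. c * f x) = c * lattice_sum f"
  using suminf_mult[OF summable_rabs_cancel, of "\<lambda>i. weight i * f (node i)" c]
  by (simp add: lattice_sum_def admissible_def mult_ac)

lemma admissible_sum:
  assumes "finite S" "\<And>s. s \<in> S \<Longrightarrow> admissible (f s)"
  shows "admissible (\<lambda>x. \<Sum>s\<in>S. c s * f s x)"
  using assms by (induction S) (simp_all add: admissible_0 admissible_add admissible_cmult)

lemma lattice_sum_sum:
  assumes "finite S" "\<And>s. s \<in> S \<Longrightarrow> admissible (f s)"
  shows "lattice_sum (\<lambda>x. \<Sum>s\<in>S. c s * f s x) = (\<Sum>s\<in>S. c s * lattice_sum (f s))"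
  using assms
proof (induction S)
  case empty
  show ?case by (simp add: lattice_sum_def)
next
  case (insert s S)
  then show ?case
    by (simp add: admissible_sum admissible_cmult lattice_sum_add lattice_sum_cmult)
qed

text \<open>
  A nonzero polynomial has finitely many roots, hence does not vanish on the infinite
  lattice.
\<close>

lemma lattice_sum_square_pos:
  assumes "p \<noteq> 0"
  shows "0 < lattice_sum (\<lambda>x. poly p x * poly p x)"
proof -
  have "\<exists>i. poly p (node i) \<noteq> 0"
  proof (rule ccontr)
    assume "\<not> ?thesis"
    then have "range node \<subseteq> {x. poly p x = 0}" by auto
    moreover have "infinite (range node)"
      using inj_node by (simp add: finite_image_iff)
    ultimately show False
      using poly_roots_finite[OF assms] finite_subset by blast
  qed
  then obtain i where i: "poly p (node i) \<noteq> 0" by blast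
  have "summable (\<lambda>i. weight i * (poly p (node i) * poly p (node i)))"
    using admissible_mult_poly[OF admissible_poly, of p p]
    unfolding admissible_def by (rule summable_rabs_cancel)
  then show ?thesis unfolding lattice_sum_def
  proof (rule suminf_pos2)
    show "0 \<le> weight n * (poly p (node n) * poly p (node n))" for n
      using weight_pos[of n] by (simp add: less_imp_le)
    show "0 < weight i * (poly p (node i) * poly p (node i))"
      using weight_pos[of i] i by (metis mult_pos_pos not_real_square_gt_zero)
  qed
qed

lemma qinner_eq_lattice_sum:
  "qinner q \<alpha> \<beta> f g = q powr ((\<alpha> + 1) * (\<beta> + 1)) * (1 - q) * lattice_sum (\<lambda>x. f x * g x)"
proof -
  have "weight i = q ^ i * q powr (real i * \<alpha>) * qpow q (q ^ (i + 1)) \<beta>" for i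
    using q_pos
    by (simp add: weight_def jackson_term_def powr_realpow[symmetric] powr_add[symmetric]
        algebra_simps)
  then show ?thesis
    by (simp add: qinner_def lattice_sum_def node_def mult_ac)
qed

section \<open>The Durrmeyer operator on the lattice\<close>

lemma bern_is_poly: "\<exists>p. bern n k = poly p \<and> (k \<le> n \<longrightarrow> degree p \<le> n)"
proof (intro exI conjI impI)
  let ?p = "monom 1 k * (\<Prod>j<n - k. [:1, - (q ^ j):])"
  show "bern n k = poly ?p"
    by (simp add: fun_eq_iff bern_def qpow_nat_def poly_monom poly_prod mult_ac)
  have "degree (\<Prod>j<n - k. [:1, - (q ^ j):]) \<le> (\<Sum>j<n - k. 1)"
    using degree_prod_sum_le[of "{..<n - k}" "\<lambda>j. [:1, - (q ^ j):]"] q_pos by simp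
  then show "degree ?p \<le> n" if "k \<le> n"
    using that by (intro order_trans[OF degree_mult_le]) (simp add: degree_monom_eq)
qed

lemma admissible_mult_bern:
  assumes "admissible f"
  shows "admissible (\<lambda>x. f x * bern n k x)"
proof -
  obtain p where "bern n k = poly p" using bern_is_poly by blast
  then show ?thesis using admissible_mult_poly[OF assms] by simp
qed

lemma qbernstein_eq_bern: "qbernstein q n k x = qbinom q n k * bern n k x"
  by (simp add: qbernstein_def bern_def)

lemma jackson_term_eq_weight:
  "jackson_term (real k + \<alpha> + 1) (real (n - k) + \<beta>) i
           = weight i * bern n k (node i) / q powr (real k * (\<beta> + 1))"
proof -
  have "q ^ Suc i = q powr (real i + 1)"
    using powr_realpow[OF q_pos, of "Suc i"] by (simp add: add.commute)
  then have x: "q powr \<beta> * q ^ Suc i = node i"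
    unfolding node_def by (simp only: powr_add[symmetric]) (simp add: add_ac)
  have 1: "q powr (real i * (real k + \<alpha> + 1)) = q powr (real i * (\<alpha> + 1)) * (node i ^ k / q powr (real k * (\<beta> + 1)))"
  proof -
    have "node i ^ k = q powr (real k * (real i + \<beta> + 1))"
      using q_pos by (simp add: node_def powr_realpow[symmetric] powr_powr mult_ac)
    then show ?thesis
      by (simp add: powr_diff[symmetric] powr_add[symmetric] algebra_simps)
  qed
  have 2: "qpow q (q ^ Suc i) (real (n - k) + \<beta>) = qpow q (q ^ Suc i) \<beta> * qpow_nat q (node i) (n - k)"
    using qpow_add_nat[of "q ^ Suc i" \<beta> "n - k"] node_less_1[of i] q_pos unfolding x
    by (simp del: of_nat_diff power_Suc)
  show ?thesis
    unfolding jackson_term_def weight_def 1 2 bern_def by (simp del: power_Suc)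
qed

text \<open>
  The constant in front depends on \<open>k\<close> but not on \<open>f\<close>, so it cancels in the Durrmeyer
  coefficient.
\<close>

lemma jackson_integral_eq_lattice_sum:
  assumes "admissible f"
  shows "jackson_integral q 1 (\<lambda>t. t powr (real k + \<alpha>) * qpow q (q * t) (real (n - k) + \<beta>)
            * f (q powr (\<beta> + 1) * t))
         = (1 - q) / q powr (real k * (\<beta> + 1)) * lattice_sum (\<lambda>x. f x * bern n k x)"
proof -
  have "q ^ i * ((q ^ i * 1) powr (real k + \<alpha>) * qpow q (q * (q ^ i * 1)) (real (n - k) + \<beta>)
            * f (q powr (\<beta> + 1) * (q ^ i * 1)))
      = 1 / q powr (real k * (\<beta> + 1)) * (weight i * (f (node i) * bern n k (node i)))" for i
  proof -
    have "q powr (\<beta> + 1) * q ^ i = node i"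
      using q_pos by (simp add: node_def powr_realpow[symmetric] powr_add[symmetric] add_ac)
    moreover have "q ^ i * (q ^ i) powr (real k + \<alpha>) = q powr (real i * (real k + \<alpha> + 1))"
      using q_pos by (simp add: powr_realpow[symmetric] powr_powr powr_add[symmetric] algebra_simps)
    ultimately have "q ^ i * ((q ^ i * 1) powr (real k + \<alpha>) * qpow q (q * (q ^ i * 1)) (real (n - k) + \<beta>)
            * f (q powr (\<beta> + 1) * (q ^ i * 1)))
        = jackson_term (real k + \<alpha> + 1) (real (n - k) + \<beta>) i * f (node i)"
      unfolding jackson_term_def by (simp add: mult.assoc[symmetric])
    then show ?thesis
      unfolding jackson_term_eq_weight by simp
  qed
  then show ?thesis
    unfolding jackson_integral_def lattice_sum_def
    using suminf_mult[OF summable_rabs_cancel,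
        of "\<lambda>i. weight i * (f (node i) * bern n k (node i))" "1 / q powr (real k * (\<beta> + 1))"]
      admissible_mult_bern[OF assms, of n k]
    by (simp add: admissible_def)
qed

lemma qDurrmeyer_coeff_eq_lattice_sum:
  assumes "admissible f"
  shows "qDurrmeyer_coeff q \<alpha> \<beta> n k f = lattice_sum (\<lambda>x. f x * bern n k x) / lattice_sum (bern n k)"
  using jackson_integral_eq_lattice_sum[OF assms] jackson_integral_eq_lattice_sum[OF admissible_1]
    q_pos q_less_1
  unfolding qDurrmeyer_coeff_def by simp

lemma lattice_sum_bern:
  "lattice_sum (\<lambda>x. x ^ m * bern n k x)
           = q powr (real (k + m) * (\<beta> + 1)) * qbeta_sum (real k + \<alpha> + 1 + real m) (real (n - k) + \<beta>)"
proof -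
  have "weight i * (node i ^ m * bern n k (node i))
      = q powr (real (k + m) * (\<beta> + 1)) * jackson_term (real k + \<alpha> + 1 + real m) (real (n - k) + \<beta>) i"
    for i
  proof -
    have "jackson_term (real k + \<alpha> + 1 + real m) (real (n - k) + \<beta>) i
        = q powr (real i * real m) * jackson_term (real k + \<alpha> + 1) (real (n - k) + \<beta>) i"
      by (simp add: jackson_term_def powr_add[symmetric] distrib_left add_ac)
    moreover have "node i ^ m = q powr (real i * real m) * q powr (real m * (\<beta> + 1))"
      using q_pos
      by (simp add: node_def powr_realpow[symmetric] powr_powr powr_add[symmetric] algebra_simps)
    moreover have "q powr (real (k + m) * (\<beta> + 1)) = q powr (real k * (\<beta> + 1)) * q powr (real m * (\<beta> + 1))"
      by (simp add: powr_add[symmetric] algebra_simps)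
    ultimately show ?thesis
      using q_pos by (simp add: jackson_term_eq_weight)
  qed
  moreover have "summable (jackson_term (real k + \<alpha> + 1 + real m) (real (n - k) + \<beta>))"
    using alpha beta by (intro summable_jackson_term) auto
  ultimately show ?thesis
    unfolding lattice_sum_def qbeta_sum_def by (simp add: suminf_mult)
qed

text \<open>
  The factor of the $m$-th moment of a normalised Bernstein polynomial that is independent of its
  index \<open>k\<close>.
\<close>

definition moment_factor :: "nat \<Rightarrow> nat \<Rightarrow> real" where
  "moment_factor n m = q powr (real m * (\<beta> + 1)) / (\<Prod>j<m. 1 - q powr (real n + \<alpha> + \<beta> + 2 + real j))"

text \<open>
  A quotient of two $q$-beta sums whose first parameters differ by \<open>m\<close>. The sum of
  the two parameters does not depend on \<open>k\<close>, so the denominators are common to all Bernstein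
  polynomials and only a polynomial in $q^k$ of degree \<open>m\<close> remains.
\<close>

lemma bern_moment:
  assumes "k \<le> n"
  shows "lattice_sum (\<lambda>x. x ^ m * bern n k x) / lattice_sum (bern n k)
           = moment_factor n m * (\<Prod>j<m. 1 - q powr \<alpha> * q ^ Suc j * q ^ k)"
proof -
  let ?s = "real k + \<alpha> + 1" and ?b = "real (n - k) + \<beta>"
  have sb: "0 < ?s" "-1 < ?b" using alpha beta by auto
  have num: "1 - q powr (?s + real j) = 1 - q powr \<alpha> * q ^ Suc j * q ^ k" for j
    using q_pos by (simp add: powr_add powr_realpow mult_ac)
  have den: "?s + ?b + 1 + real j = real n + \<alpha> + \<beta> + 2 + real j" for j
    using assms by simp
  have "lattice_sum (\<lambda>x. x ^ m * bern n k x) / lattice_sum (bern n k)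
      = q powr (real m * (\<beta> + 1)) * (qbeta_sum (?s + real m) ?b / qbeta_sum ?s ?b)"
    using lattice_sum_bern[of m n k] lattice_sum_bern[of 0 n k] q_pos
    by (simp add: powr_add distrib_right del: of_nat_diff)
  also have "qbeta_sum (?s + real m) ?b / qbeta_sum ?s ?b
      = (\<Prod>j<m. (1 - q powr (?s + real j)) / (1 - q powr (?s + ?b + 1 + real j)))"
    using qbeta_sum_add_nat[OF sb, of m] qbeta_sum_pos[OF sb] by simp
  finally show ?thesis
    unfolding num den moment_factor_def prod_dividef by simp
qed

lemma qDurrmeyer_admissible:
  assumes "admissible f"
  shows "qDurrmeyer q \<alpha> \<beta> n f x
    = (\<Sum>k\<le>n. qbinom q n k * lattice_sum (\<lambda>x. f x * bern n k x) / lattice_sum (bern n k) * bern n k x)"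
  unfolding qDurrmeyer_def
  by (intro sum.cong refl) (simp add: qDurrmeyer_coeff_eq_lattice_sum[OF assms] qbernstein_eq_bern)

lemma lattice_sum_qDurrmeyer:
  assumes "admissible f"
  shows "lattice_sum (\<lambda>x. qDurrmeyer q \<alpha> \<beta> n f x * poly p x)
    = (\<Sum>k\<le>n. qbinom q n k * lattice_sum (\<lambda>x. f x * bern n k x) / lattice_sum (bern n k)
               * lattice_sum (\<lambda>x. poly p x * bern n k x))"
proof -
  have "(\<lambda>x. qDurrmeyer q \<alpha> \<beta> n f x * poly p x)
      = (\<lambda>x. \<Sum>k\<le>n. qbinom q n k * lattice_sum (\<lambda>x. f x * bern n k x) / lattice_sum (bern n k)
                    * (poly p x * bern n k x))"
    unfolding qDurrmeyer_admissible[OF assms] sum_distrib_right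
    by (intro ext sum.cong refl) simp
  then show ?thesis
    by (simp only:) (intro lattice_sum_sum finite_atMost admissible_mult_bern admissible_poly)
qed

text \<open>
  Both sides are the sum over $k$ of the same symmetric
  expression in the moments of $f$ and of \<open>p\<close> against \<open>bern n k\<close>.
\<close>

lemma qDurrmeyer_self_adjoint:
  assumes "admissible f"
  shows "lattice_sum (\<lambda>x. qDurrmeyer q \<alpha> \<beta> n f x * poly p x)
    = lattice_sum (\<lambda>x. f x * qDurrmeyer q \<alpha> \<beta> n (poly p) x)"
proof -
  have "(\<lambda>x. f x * qDurrmeyer q \<alpha> \<beta> n (poly p) x)
      = (\<lambda>x. \<Sum>k\<le>n. qbinom q n k * lattice_sum (\<lambda>x. poly p x * bern n k x) / lattice_sum (bern n k)
                    * (f x * bern n k x))"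
    unfolding qDurrmeyer_admissible[OF admissible_poly] sum_distrib_left
    by (intro ext sum.cong refl) simp
  then have "lattice_sum (\<lambda>x. f x * qDurrmeyer q \<alpha> \<beta> n (poly p) x)
      = (\<Sum>k\<le>n. qbinom q n k * lattice_sum (\<lambda>x. poly p x * bern n k x) / lattice_sum (bern n k)
                    * lattice_sum (\<lambda>x. f x * bern n k x))"
    by (simp only:) (intro lattice_sum_sum finite_atMost admissible_mult_bern assms)
  then show ?thesis
    unfolding lattice_sum_qDurrmeyer[OF assms] by (simp add: mult_ac)
qed

section \<open>Action on polynomials\<close>

text \<open>
  Writing the image of a polynomial in the moment polynomials makes its degree and its leading
  coefficient accessible; \<open>qDurrmeyer_poly\<close> identifies it as the image.
\<close>

definition durrmeyer_poly :: "nat \<Rightarrow> real poly \<Rightarrow> real poly" where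
  "durrmeyer_poly n p =
     (\<Sum>m\<le>degree p. smult (coeff p m * moment_factor n m) (moment_poly (q powr \<alpha>) n m))"

text \<open>
  The effect on the coefficient of $x^r$ for polynomials of degree at most \<open>r\<close>; this is the
  eigenvalue before it is rewritten in terms of $q$-factorials and $\Gamma_q$.
\<close>

definition leading_factor :: "nat \<Rightarrow> nat \<Rightarrow> real" where
  "leading_factor n r = moment_factor n r * (\<Prod>j<r. q powr \<alpha> * q ^ Suc j * (q ^ j - q ^ n))"

lemma qDurrmeyer_poly: "qDurrmeyer q \<alpha> \<beta> n (poly p) x = poly (durrmeyer_poly n p) x"
proof -
  have coeff: "lattice_sum (\<lambda>x. poly p x * bern n k x) / lattice_sum (bern n k)
      = (\<Sum>m\<le>degree p. coeff p m * moment_factor n m * (\<Prod>j<m. 1 - q powr \<alpha> * q ^ Suc j * q ^ k))"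
    if "k \<le> n" for k
  proof -
    have "admissible (\<lambda>x. x ^ m * bern n k x)" for m
      using admissible_mult_bern[OF admissible_poly[of "monom 1 m"]] by (simp add: poly_monom)
    then have "lattice_sum (\<lambda>x. \<Sum>m\<le>degree p. coeff p m * (x ^ m * bern n k x))
        = (\<Sum>m\<le>degree p. coeff p m * lattice_sum (\<lambda>x. x ^ m * bern n k x))"
      using lattice_sum_sum[of "{..degree p}" "\<lambda>m x. x ^ m * bern n k x"] by simp
    moreover have "(\<lambda>x. poly p x * bern n k x)
        = (\<lambda>x. \<Sum>m\<le>degree p. coeff p m * (x ^ m * bern n k x))"
      unfolding poly_altdef sum_distrib_right by (simp add: mult.assoc)
    ultimately have "lattice_sum (\<lambda>x. poly p x * bern n k x) / lattice_sum (bern n k)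
        = (\<Sum>m\<le>degree p. coeff p m * (lattice_sum (\<lambda>x. x ^ m * bern n k x) / lattice_sum (bern n k)))"
      by (simp add: sum_divide_distrib)
    then show ?thesis
      unfolding bern_moment[OF that] by (simp add: mult.assoc)
  qed
  have "qDurrmeyer q \<alpha> \<beta> n (poly p) x
      = (\<Sum>k\<le>n. lattice_sum (\<lambda>x. poly p x * bern n k x) / lattice_sum (bern n k) * qbernstein q n k x)"
    unfolding qDurrmeyer_admissible[OF admissible_poly] qbernstein_eq_bern
    by (intro sum.cong refl) simp
  also have "\<dots> = (\<Sum>k\<le>n. \<Sum>m\<le>degree p. coeff p m * moment_factor n m *
      ((\<Prod>j<m. 1 - q powr \<alpha> * q ^ Suc j * q ^ k) * qbernstein q n k x))"
    by (intro sum.cong refl) (simp add: coeff sum_distrib_right mult.assoc)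
  also have "\<dots> = (\<Sum>m\<le>degree p. coeff p m * moment_factor n m *
      (\<Sum>k\<le>n. (\<Prod>j<m. 1 - q powr \<alpha> * q ^ Suc j * q ^ k) * qbernstein q n k x))"
    by (subst sum.swap) (simp only: sum_distrib_left)
  also have "\<dots> = poly (durrmeyer_poly n p) x"
    unfolding sum_moment_qbernstein durrmeyer_poly_def by (simp add: poly_sum)
  finally show ?thesis .
qed

lemma coeff_durrmeyer_poly:
  assumes "degree p \<le> d"
  shows "coeff (durrmeyer_poly n p) d = leading_factor n d * coeff p d"
proof -
  have "coeff (durrmeyer_poly n p) d
      = (\<Sum>m\<le>degree p. coeff p m * moment_factor n m * coeff (moment_poly (q powr \<alpha>) n m) d)"
    by (simp add: durrmeyer_poly_def coeff_sum)
  also have "\<dots> = (\<Sum>m\<le>degree p. if m = d then leading_factor n d * coeff p d else 0)"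
  proof (intro sum.cong refl)
    fix m assume "m \<in> {..degree p}"
    then have "m = d \<or> m < d" using assms by auto
    then show "coeff p m * moment_factor n m * coeff (moment_poly (q powr \<alpha>) n m) d
        = (if m = d then leading_factor n d * coeff p d else 0)"
      using coeff_moment_poly[of m "q powr \<alpha>" n] by (auto simp: leading_factor_def)
  qed
  also have "\<dots> = leading_factor n d * coeff p d"
    by (auto simp: coeff_eq_0)
  finally show ?thesis .
qed

lemma degree_durrmeyer_poly: "degree (durrmeyer_poly n p) \<le> degree p"
proof (rule degree_le, intro allI impI)
  fix d assume "degree p < d"
  then show "coeff (durrmeyer_poly n p) d = 0"
    using coeff_durrmeyer_poly[of p d n] by (simp add: coeff_eq_0)
qed

lemma qDurrmeyer_is_poly:
  assumes "admissible f"
  obtains p where "degree p \<le> n" "qDurrmeyer q \<alpha> \<beta> n f = poly p"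
proof -
  obtain b where b: "\<And>k. bern n k = poly (b k)" and "\<And>k. k \<le> n \<Longrightarrow> degree (b k) \<le> n"
    using bern_is_poly[of n] by metis
  then have "degree (\<Sum>k\<le>n. smult (qbinom q n k * lattice_sum (\<lambda>x. f x * bern n k x) / lattice_sum (bern n k)) (b k)) \<le> n"
    by (intro degree_sum_le) (auto intro: order_trans[OF degree_smult_le])
  moreover have "qDurrmeyer q \<alpha> \<beta> n f
      = poly (\<Sum>k\<le>n. smult (qbinom q n k * lattice_sum (\<lambda>x. f x * bern n k x) / lattice_sum (bern n k)) (b k))"
    using qDurrmeyer_admissible[OF assms] b by (simp add: fun_eq_iff poly_sum)
  ultimately show ?thesis by (rule that)
qed

section \<open>Convergence under the growth condition\<close>

text \<open>
  A bound $|f(x)|\le Bx^{-\gamma}$ near \<open>0\<close> turns the weight with exponent $\alpha$ into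
  the one with exponent $\alpha-\gamma>-1$, which is still summable.
\<close>

lemma condition_C_imp_admissible:
  assumes "condition_C \<alpha> f"
  shows "admissible f"
proof -
  obtain \<gamma> A where g: "\<alpha> > \<gamma> - 1" and A: "0 < A"
    and bdd: "bounded ((\<lambda>x. x powr \<gamma> * f x) ` ({0<..A} \<inter> {0<..<1}))"
    using assms unfolding condition_C_def by auto
  obtain B where B: "\<And>x. 0 < x \<Longrightarrow> x \<le> A \<Longrightarrow> x < 1 \<Longrightarrow> \<bar>x powr \<gamma> * f x\<bar> \<le> B"
    using bdd unfolding bounded_iff by fastforce
  have "eventually (\<lambda>i. node i < A) sequentially"
    using order_tendstoD(2)[OF node_tendsto_0 A] .
  then have ev: "eventually (\<lambda>i. norm \<bar>weight i * f (node i)\<bar>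
      \<le> B / q powr (\<gamma> * (\<beta> + 1)) * jackson_term (\<alpha> + 1 - \<gamma>) \<beta> i) sequentially"
  proof eventually_elim
    case (elim i)
    have eq: "weight i = node i powr \<gamma> * (jackson_term (\<alpha> + 1 - \<gamma>) \<beta> i / q powr (\<gamma> * (\<beta> + 1)))"
    proof -
      have "q powr (real i * (\<alpha> + 1)) = node i powr \<gamma> * (q powr (real i * (\<alpha> + 1 - \<gamma>)) / q powr (\<gamma> * (\<beta> + 1)))"
        by (simp add: node_def powr_powr powr_diff[symmetric] powr_add[symmetric] algebra_simps)
      then show ?thesis by (simp add: weight_def jackson_term_def)
    qed
    have j: "0 < jackson_term (\<alpha> + 1 - \<gamma>) \<beta> i / q powr (\<gamma> * (\<beta> + 1))"
      using jackson_term_pos[OF beta] q_pos by simp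
    have "norm \<bar>weight i * f (node i)\<bar> = \<bar>node i powr \<gamma> * f (node i)\<bar>
          * (jackson_term (\<alpha> + 1 - \<gamma>) \<beta> i / q powr (\<gamma> * (\<beta> + 1)))"
      unfolding eq using jackson_term_pos[OF beta, of "\<alpha> + 1 - \<gamma>" i] by (simp add: abs_mult)
    also have "\<dots> \<le> B * (jackson_term (\<alpha> + 1 - \<gamma>) \<beta> i / q powr (\<gamma> * (\<beta> + 1)))"
      using B[of "node i"] node_pos[of i] node_less_1[of i] elim j by (intro mult_right_mono) auto
    finally show ?case by simp
  qed
  show ?thesis
    unfolding admissible_def
    by (rule summable_comparison_test_ev[OF ev])
       (use g beta in \<open>auto intro!: summable_mult summable_jackson_term\<close>)
qed

section \<open>The eigenvalue in closed form\<close>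

lemma qGamma_add_1:
  assumes "0 < s"
  shows "qGamma q (s + 1) = qnum q s * qGamma q s" and "0 < qGamma q s"
proof -
  have pos: "0 < qpow q q a" if "-1 < a" for a
    using qpow_lattice_pos[OF that, of 0] by simp
  have "q powr (s - 1) * q = q powr s"
    using q_pos by (simp add: powr_diff)
  then have "qpow q q (1 + (s - 1)) = qpow q q (s - 1) * (1 - q powr s)"
    using qpow_add_nat[of q "s - 1" 1] assms q_pos by (simp add: qpow_nat_def q_powr_less_1)
  moreover have "(1 - q) powr s = (1 - q) * (1 - q) powr (s - 1)"
    using q_less_1 by (simp add: powr_diff)
  ultimately show "qGamma q (s + 1) = qnum q s * qGamma q s"
    by (simp add: qGamma_def qnum_def)
  show "0 < qGamma q s"
    using pos[of "s - 1"] assms q_less_1 by (simp add: qGamma_def)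
qed

text \<open>
  Induction on $r$: both sides are multiplied by the same factor when \<open>r\<close> grows to \<open>r + 1\<close>.
  At $r=n$ that factor contains $q^r-q^n=0$, which accounts for the case distinction in the
  eigenvalue.
\<close>

lemma qeigenvalue_eq: "qeigenvalue q \<alpha> \<beta> n r = leading_factor n r"
proof (induction r)
  case 0
  have "0 < qGamma q (real n + \<alpha> + \<beta> + 2)" using alpha beta by (intro qGamma_add_1(2)) auto
  then show ?case
    using qfact_nonzero by (simp add: qeigenvalue_def leading_factor_def moment_factor_def)
next
  case (Suc r)
  let ?t = "real n + \<alpha> + \<beta> + 2 + real r"
  have step: "leading_factor n (Suc r) = leading_factor n r *
      (q powr (\<beta> + 1) * (q powr \<alpha> * q ^ Suc r * (q ^ r - q ^ n)) / (1 - q powr ?t))"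
  proof -
    have "q powr (real (Suc r) * (\<beta> + 1)) = q powr (real r * (\<beta> + 1)) * q powr (\<beta> + 1)"
      by (simp add: powr_add[symmetric] algebra_simps)
    then show ?thesis by (simp add: leading_factor_def moment_factor_def)
  qed
  show ?case
  proof (cases "Suc r \<le> n")
    case False
    show ?thesis
    proof (cases "r = n")
      case True
      then show ?thesis unfolding step by (simp add: qeigenvalue_def)
    next
      case r: False
      with False have "leading_factor n r = 0"
        using Suc.IH by (simp add: qeigenvalue_def)
      then show ?thesis unfolding step using False by (simp add: qeigenvalue_def)
    qed
  next
    case True
    then obtain d where d: "n = Suc (r + d)"
      by (metis add_Suc le_Suc_ex)
    have t: "0 < ?t" using alpha beta by simp
    have g: "qGamma q (real n + real (Suc r) + \<alpha> + \<beta> + 2)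
        = qnum q ?t * qGamma q (real n + real r + \<alpha> + \<beta> + 2)"
      using qGamma_add_1(1)[OF t] by (simp add: add_ac)
    have f: "qfact q (n - r) = qfact q (n - Suc r) * (1 - q ^ (n - r)) / (1 - q)"
      using qfact_Suc[of d] by (simp add: d)
    have pw: "q powr (real (Suc r) * (real (Suc r) + \<alpha> + \<beta> + 1))
        = q powr (real r * (real r + \<alpha> + \<beta> + 1))
          * (q powr (\<beta> + 1) * (q powr \<alpha> * q ^ Suc r * q ^ r))"
      using q_pos by (simp add: powr_realpow[symmetric] powr_add[symmetric] powr_mult_base algebra_simps)
    have diff: "q ^ r - q ^ n = q ^ r * (1 - q ^ (n - r))"
      using True by (simp add: algebra_simps power_add[symmetric])
    have field_identity: "E * (c * (a * s * u)) * (N / F) * (G0 / (Y / h * G))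
        = E * (N / (F * X / h)) * (G0 / G) * (c * (a * s * (u * X)) / Y)"
      if "X \<noteq> 0" "Y \<noteq> 0" "h \<noteq> 0" for E c a s u N F G0 G X Y h :: real
      using that by (simp add: mult_ac)
    have "1 - q ^ (n - r) \<noteq> 0"
      using q_pos q_less_1 power_Suc_less_one[of q d] by (simp add: d)
    moreover have "1 - q powr ?t \<noteq> 0" using q_powr_less_1[OF t] by simp
    moreover have "1 - q \<noteq> 0" using q_less_1 by simp
    moreover have "r \<le> n" using True by simp
    ultimately show ?thesis
      unfolding step Suc.IH[symmetric] qeigenvalue_def g f pw diff
      using True by (simp only: if_True qnum_def) (rule field_identity; assumption)
  qed
qed

end

section \<open>Orthogonal polynomials as eigenvectors\<close>

locale q_jacobi_polys = q_durrmeyer +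
  fixes P :: "nat \<Rightarrow> real poly"
  assumes degree_P: "degree (P r) = r"
    and P_nonzero: "P r \<noteq> 0"
    and orth: "r \<noteq> s \<Longrightarrow> lattice_sum (\<lambda>x. poly (P r) x * poly (P s) x) = 0"
begin

lemma poly_expansion_exists:
  assumes "degree p \<le> d"
  shows "\<exists>a. p = (\<Sum>r\<le>d. smult (a r) (P r))"
  using assms
proof (induction d arbitrary: p)
  case 0
  obtain c where c: "p = [:c:]" using 0 degree_eq_zeroE by auto
  obtain c' where c': "P 0 = [:c':]" using degree_P[of 0] degree_eq_zeroE by auto
  with P_nonzero[of 0] have "c' \<noteq> 0" by auto
  then have "p = smult (c / c') (P 0)" by (simp add: c c')
  then show ?case by (intro exI[of _ "\<lambda>_. c / c'"]) simp
next
  case (Suc d)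
  have lc: "coeff (P (Suc d)) (Suc d) \<noteq> 0"
    using P_nonzero[of "Suc d"] degree_P[of "Suc d"] by (metis leading_coeff_0_iff)
  define c where "c = coeff p (Suc d) / coeff (P (Suc d)) (Suc d)"
  have "degree (p - smult c (P (Suc d))) \<le> d"
  proof (rule degree_le, intro allI impI)
    fix i assume "d < i"
    then consider "i = Suc d" | "Suc d < i" by linarith
    then show "coeff (p - smult c (P (Suc d))) i = 0"
      using lc Suc.prems degree_P[of "Suc d"] by cases (auto simp: c_def coeff_eq_0)
  qed
  then obtain a where a: "p - smult c (P (Suc d)) = (\<Sum>r\<le>d. smult (a r) (P r))"
    using Suc.IH by blast
  have "p = (\<Sum>r\<le>Suc d. smult ((a(Suc d := c)) r) (P r))"
    using a by (simp add: algebra_simps)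
  then show ?case by blast
qed

abbreviation "sqnorm r \<equiv> lattice_sum (\<lambda>x. poly (P r) x * poly (P r) x)"

lemma sqnorm_pos: "0 < sqnorm r"
  using lattice_sum_square_pos[OF P_nonzero] .

lemma lattice_sum_expansion:
  "lattice_sum (\<lambda>x. poly (\<Sum>r\<le>d. smult (a r) (P r)) x * poly (P s) x)
     = (if s \<le> d then a s * sqnorm s else 0)"
proof -
  have "(\<lambda>x. poly (\<Sum>r\<le>d. smult (a r) (P r)) x * poly (P s) x)
      = (\<lambda>x. \<Sum>r\<le>d. a r * (poly (P r) x * poly (P s) x))"
    unfolding poly_sum sum_distrib_right by (simp add: mult.assoc)
  then have "lattice_sum (\<lambda>x. poly (\<Sum>r\<le>d. smult (a r) (P r)) x * poly (P s) x)
      = (\<Sum>r\<le>d. a r * lattice_sum (\<lambda>x. poly (P r) x * poly (P s) x))"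
    using lattice_sum_sum[of "{..d}" "\<lambda>r x. poly (P r) x * poly (P s) x" a]
      admissible_mult_poly[OF admissible_poly] by simp
  also have "\<dots> = (\<Sum>r\<le>d. if r = s then a s * sqnorm s else 0)"
    by (intro sum.cong refl) (auto simp: orth)
  finally show ?thesis by simp
qed

lemma fourier_expansion:
  assumes "degree p \<le> d"
  shows "p = (\<Sum>r\<le>d. smult (lattice_sum (\<lambda>x. poly p x * poly (P r) x) / sqnorm r) (P r))"
proof -
  obtain a where a: "p = (\<Sum>r\<le>d. smult (a r) (P r))"
    using poly_expansion_exists[OF assms] by blast
  have "lattice_sum (\<lambda>x. poly p x * poly (P r) x) / sqnorm r = a r" if "r \<le> d" for r
    unfolding a lattice_sum_expansion using that sqnorm_pos[of r] by simp
  then have "(\<Sum>r\<le>d. smult (lattice_sum (\<lambda>x. poly p x * poly (P r) x) / sqnorm r) (P r))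
      = (\<Sum>r\<le>d. smult (a r) (P r))"
    by (intro sum.cong refl) simp
  also have "\<dots> = p" by (rule a[symmetric])
  finally show ?thesis ..
qed

lemma orth_lower_degree:
  assumes "degree p < r"
  shows "lattice_sum (\<lambda>x. poly (P r) x * poly p x) = 0"
proof -
  obtain a where "p = (\<Sum>s\<le>degree p. smult (a s) (P s))"
    using poly_expansion_exists[OF order_refl] by blast
  then have "lattice_sum (\<lambda>x. poly p x * poly (P r) x) = 0"
    using lattice_sum_expansion[of a "degree p" r] assms by simp
  then show ?thesis by (simp add: mult.commute)
qed

text \<open>
  The image of \<open>P r\<close> has degree at most \<open>r\<close>. By self-adjointness its Fourier coefficient at
  \<open>P s\<close> with \<open>s < r\<close> pairs \<open>P r\<close> with the image of \<open>P s\<close>, a polynomial of degree less than \<open>r\<close>,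
  and vanishes. So the image is a multiple of \<open>P r\<close>, and comparing leading coefficients identifies
  the multiple.
\<close>

lemma durrmeyer_eigen: "durrmeyer_poly n (P r) = smult (leading_factor n r) (P r)"
proof -
  let ?D = "durrmeyer_poly n (P r)"
  let ?a = "\<lambda>s. lattice_sum (\<lambda>x. poly ?D x * poly (P s) x) / sqnorm s"
  have deg: "degree ?D \<le> r" using degree_durrmeyer_poly[of n "P r"] degree_P by simp
  have "?a s = 0" if "s < r" for s
  proof -
    have "lattice_sum (\<lambda>x. poly ?D x * poly (P s) x)
        = lattice_sum (\<lambda>x. poly (P r) x * poly (durrmeyer_poly n (P s)) x)"
      using qDurrmeyer_self_adjoint[OF admissible_poly, of n "P r" "P s"]
      by (simp add: qDurrmeyer_poly)
    also have "\<dots> = 0"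
      using degree_durrmeyer_poly[of n "P s"] degree_P that by (intro orth_lower_degree) simp
    finally show ?thesis by simp
  qed
  then have "(\<Sum>s\<le>r. smult (?a s) (P s)) = (\<Sum>s\<le>r. if s = r then smult (?a r) (P r) else 0)"
    by (intro sum.cong refl) (auto simp: le_less)
  then have D: "?D = smult (?a r) (P r)"
    using fourier_expansion[OF deg] by simp
  have "coeff ?D r = leading_factor n r * coeff (P r) r"
    by (rule coeff_durrmeyer_poly) (simp add: degree_P)
  moreover have "coeff (P r) r \<noteq> 0"
    using P_nonzero degree_P by (metis leading_coeff_0_iff)
  moreover have "coeff ?D r = ?a r * coeff (P r) r"
    using D by (metis coeff_smult)
  ultimately have "?a r = leading_factor n r"
    by (metis mult_right_cancel)
  then show ?thesis using D by simp
qed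

lemma qDurrmeyer_eigen:
  "qDurrmeyer q \<alpha> \<beta> n (poly (P r)) x = leading_factor n r * poly (P r) x"
  by (simp add: qDurrmeyer_poly durrmeyer_eigen)

text \<open>
  The image of \<open>f\<close> is a polynomial and equals its Fourier sum; self-adjointness moves the operator
  onto the eigenvector \<open>P r\<close> in each Fourier coefficient.
\<close>

lemma qDurrmeyer_spectral:
  assumes "admissible f"
  shows "qDurrmeyer q \<alpha> \<beta> n f x
    = (\<Sum>r\<le>n. leading_factor n r * (lattice_sum (\<lambda>x. f x * poly (P r) x) / sqnorm r) * poly (P r) x)"
proof -
  obtain p where p: "degree p \<le> n" "qDurrmeyer q \<alpha> \<beta> n f = poly p"
    using qDurrmeyer_is_poly[OF assms] by blast
  have lattice_sum_p: "lattice_sum (\<lambda>x. poly p x * poly (P r) x)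
      = leading_factor n r * lattice_sum (\<lambda>x. f x * poly (P r) x)" for r
  proof -
    have "lattice_sum (\<lambda>x. poly p x * poly (P r) x)
        = lattice_sum (\<lambda>x. leading_factor n r * (f x * poly (P r) x))"
      using qDurrmeyer_self_adjoint[OF assms, of n "P r"]
      by (simp add: p(2) qDurrmeyer_eigen mult_ac)
    then show ?thesis using lattice_sum_cmult[OF admissible_mult_poly[OF assms]] by simp
  qed
  have "p = (\<Sum>r\<le>n.
      smult (leading_factor n r * lattice_sum (\<lambda>x. f x * poly (P r) x) / sqnorm r) (P r))"
    by (subst fourier_expansion[OF p(1)]) (simp only: lattice_sum_p)
  then have "poly p x = (\<Sum>r\<le>n.
      leading_factor n r * lattice_sum (\<lambda>x. f x * poly (P r) x) / sqnorm r * poly (P r) x)"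
    by (simp add: poly_sum)
  then show ?thesis by (simp add: p(2))
qed

end

theorem proposition4:
  fixes q \<alpha> \<beta> :: real and P :: "nat \<Rightarrow> real poly"
  assumes "0 < q" and "q < 1" and "\<alpha> > -1" and "\<beta> > -1"
    and "orthogonal_poly_seq q \<alpha> \<beta> P"
  shows "(\<forall>n r. \<forall>x. qDurrmeyer q \<alpha> \<beta> n (poly (P r)) x = qeigenvalue q \<alpha> \<beta> n r * poly (P r) x) \<and>
         (\<forall>f :: real \<Rightarrow> real. condition_C \<alpha> f \<longrightarrow>
            (\<forall>n. \<forall>x. qDurrmeyer q \<alpha> \<beta> n f x =
               (\<Sum>r=0..n. qeigenvalue q \<alpha> \<beta> n r
                  * (qinner q \<alpha> \<beta> f (poly (P r)) / qinner q \<alpha> \<beta> (poly (P r)) (poly (P r)))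
                  * poly (P r) x)))"
proof -
  interpret q_durrmeyer q \<alpha> \<beta>
    using assms by unfold_locales
  interpret q_jacobi_polys q \<alpha> \<beta> P
  proof
    show "degree (P r) = r" for r
      using assms(5) by (simp add: orthogonal_poly_seq_def)
    \<comment> \<open>The degree condition allows \<open>P 0 = 0\<close>; only the normalisation at \<open>0\<close> excludes it.\<close>
    show "P r \<noteq> 0" for r
    proof (cases "r = 0")
      case True
      have "poly (P 0) 0 = 1"
        using assms(5) by (simp add: orthogonal_poly_seq_def qfact_def)
      then show ?thesis using True by auto
    next
      case False
      then show ?thesis using assms(5) unfolding orthogonal_poly_seq_def by (metis degree_0)
    qed
    show "lattice_sum (\<lambda>x. poly (P r) x * poly (P s) x) = 0" if "r \<noteq> s" for r s
    proof -
      have "qinner q \<alpha> \<beta> (poly (P r)) (poly (P s)) = 0"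
        using assms(5) that by (simp add: orthogonal_poly_seq_def)
      then show ?thesis
        unfolding qinner_eq_lattice_sum using q_pos q_less_1 by simp
    qed
  qed
  have ratio: "qinner q \<alpha> \<beta> f (poly (P r)) / qinner q \<alpha> \<beta> (poly (P r)) (poly (P r))
      = lattice_sum (\<lambda>x. f x * poly (P r) x) / sqnorm r" for f r
    unfolding qinner_eq_lattice_sum using q_pos q_less_1 by simp
  show ?thesis
    unfolding ratio qeigenvalue_eq atLeast0AtMost
    using qDurrmeyer_eigen qDurrmeyer_spectral condition_C_imp_admissible by blast
qed

end
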